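(* Let $f(u,\beta)=h(u)\,(A(\beta)-B(\beta)h'(u))$ be a monostable nonlinearity of solvable type, depending on a parameter $\beta\in\mathbb{R}$. Let $c_{min}(\beta)$ be the minimal front speed of $u_t=u_{xx}+f(u,\beta)$, and let $c_{nl}(\beta)=A(\beta)/\sqrt{B(\beta)}$. Then for all $\beta$ such that $A(\beta)<2B(\beta)$, one has $c_{min}(\beta)=c_{nl}(\beta)$.
   Context: Let $\beta\in\mathbb{R}$ be a parameter. The nonlinearity $f(u,\beta)$ is monostable if (with $'$ on $f$ denoting the derivative in $u$) $f(0,\beta)=f(1,\beta)=0$, $f'(0,\beta)>0$, $f'(1,\beta)<0$ and $f(u,\beta)>0$ for $u\in(0,1)$. It is of solvable type if it can be written as $f(u,\beta)=h(u)\,(A(\beta)-B(\beta)h'(u))$, where $h$ is a function of $u$ alone with $h(0)=h(1)=0$, $h(u)\ge 0$ and (without loss of generality) $h'(0)=1$, and where $A(\beta)>0$, $B(\beta)>0$, and $A(\beta)-B(\beta)h'(u)>0$ for all $u\in[0,1]$. For $c\ge 0$, a monotone front of speed $c$ for $u_t=u_{xx}+f(u,\beta)$ is a monotone solution $U(z)$, $z=x-ct$, of $U''+cU'+f(U,\beta)=0$ with $\lim_{z\to-\infty}U(z)=1$ and $\lim_{z\to\infty}U(z)=0$. There are no monotone fronts for $c<2\sqrt{f'(0,\beta)}$, and the minimal speed $c_{min}(\beta)\ge 2\sqrt{f'(0,\beta)}$ is the smallest number such that a monotone front of speed $c$ exists for all $c\ge c_{min}(\beta)$. The number $c_{nl}(\beta)=A(\beta)/\sqrt{B(\beta)}$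 is the speed of the explicit front determined by $-U'=\sqrt{B(\beta)}\,h(U)$. *)

theory Defs
  imports Complex_Main
begin

text \<open>
  Nonlinearities are total functions on the reals, but only their values on \<open>[0,1]\<close> matter.
  Hence derivatives in \<open>u\<close> are taken within \<open>[0,1]\<close>, that is, one-sided at the two end points.
\<close>

definition monostable :: "(real \<Rightarrow> real \<Rightarrow> real) \<Rightarrow> real \<Rightarrow> bool" where
  "monostable f \<beta> \<longleftrightarrow>
     f 0 \<beta> = 0 \<and> f 1 \<beta> = 0 \<and>
     (\<exists>D>0. ((\<lambda>u. f u \<beta>) has_real_derivative D) (at 0 within {0..1})) \<and>
     (\<exists>D<0. ((\<lambda>u. f u \<beta>) has_real_derivative D) (at 1 within {0..1})) \<and>
     (\<forall>u\<in>{0<..<1}. 0 < f u \<beta>)"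

text \<open>The argument \<open>h'\<close> is the derivative of \<open>h\<close> on \<open>[0,1]\<close>; it need not be continuous.\<close>

definition solvable_type ::
  "(real \<Rightarrow> real \<Rightarrow> real) \<Rightarrow> (real \<Rightarrow> real) \<Rightarrow> (real \<Rightarrow> real) \<Rightarrow> (real \<Rightarrow> real) \<Rightarrow> (real \<Rightarrow> real) \<Rightarrow> bool"
where
  "solvable_type f h h' A B \<longleftrightarrow>
     (\<forall>u\<in>{0..1}. (h has_real_derivative h' u) (at u within {0..1})) \<and>
     h 0 = 0 \<and> h 1 = 0 \<and> (\<forall>u\<in>{0..1}. 0 \<le> h u) \<and> h' 0 = 1 \<and>
     (\<forall>\<beta>. 0 < A \<beta> \<and> 0 < B \<beta> \<and> (\<forall>u\<in>{0..1}. 0 < A \<beta> - B \<beta> * h' u)) \<and>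
     (\<forall>\<beta>. \<forall>u\<in>{0..1}. f u \<beta> = h u * (A \<beta> - B \<beta> * h' u))"

text \<open>Given the two limits, a monotone profile is necessarily nonincreasing.\<close>

definition monotone_front ::
  "(real \<Rightarrow> real \<Rightarrow> real) \<Rightarrow> real \<Rightarrow> real \<Rightarrow> (real \<Rightarrow> real) \<Rightarrow> bool" where
  "monotone_front f \<beta> c U \<longleftrightarrow>
     antimono U \<and>
     (\<exists>U' U''. \<forall>z. (U has_real_derivative U' z) (at z) \<and>
                   (U' has_real_derivative U'' z) (at z) \<and>
                   U'' z + c * U' z + f (U z) \<beta> = 0) \<and>
     (U \<longlongrightarrow> 1) at_bot \<and> (U \<longlongrightarrow> 0) at_top"

definition c_min :: "(real \<Rightarrow> real \<Rightarrow> real) \<Rightarrow> real \<Rightarrow> real" where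
  "c_min f \<beta> = (LEAST c. 0 \<le> c \<and> (\<forall>c'\<ge>c. \<exists>U. monotone_front f \<beta> c' U))"

definition c_nl :: "(real \<Rightarrow> real) \<Rightarrow> (real \<Rightarrow> real) \<Rightarrow> real \<Rightarrow> real" where
  "c_nl A B \<beta> = A \<beta> / sqrt (B \<beta>)"

end

theory Submission
  imports Defs "HOL-Complex_Analysis.Great_Picard"
begin

text \<open>
  Write \<open>p = -U'\<close> for the steepness of a front at height \<open>u = U\<close>. The front equation becomes
  \<open>p p' = c p - f\<close>, and \<open>f = h (A - B h')\<close> makes \<open>w = p\<^sup>2 - B h\<^sup>2\<close> the right unknown:
  it satisfies \<open>w' = 2 (c p - A h)\<close> with \<open>p = sqrt (w + B h\<^sup>2)\<close>. The derivative \<open>h'\<close>, which may be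
  discontinuous, has dropped out, and the explicit front of speed \<open>c_nl = A / sqrt B\<close> is the
  solution \<open>w = 0\<close>. Fronts of other speeds are compared with it through the sign of \<open>w\<close>.

  If \<open>c \<ge> c_nl\<close>, Peano's theorem (\<open>Peano_existence\<close>) gives a solution \<open>w\<close> that starts from
  \<open>w 1 = 0\<close> and runs towards \<open>u = 0\<close>. The barrier \<open>w = 0\<close> keeps \<open>w \<le> 0\<close>, and \<open>f > 0\<close> keeps
  \<open>p > 0\<close> (\<open>trajectory_exists\<close>). Thus \<open>0 < p \<le> sqrt B h\<close> vanishes at least linearly at \<open>0\<close> and \<open>1\<close>, and
  the autonomous equation \<open>U' = - p U\<close> has a solution that takes infinite time to reach \<open>0\<close> and
  \<open>1\<close> (\<open>decreasing_profile_exists\<close>). It is a front of speed \<open>c\<close> (\<open>monotone_front_exists\<close>).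

  If \<open>0 \<le> c < c_nl\<close>, the same barrier forces \<open>w \<ge> 0\<close> along every front, that is
  \<open>- U' \<ge> sqrt B h(U)\<close>. At \<open>u = 0\<close> the decay rate \<open>r = - U' / U\<close> obeys, up to vanishing terms,
  \<open>r' = r\<^sup>2 - c r + (A - B)\<close>, whose right hand side equals \<open>A - c sqrt B > 0\<close> at \<open>r = sqrt B\<close>.
  The condition \<open>A < 2 B\<close> gives \<open>c < 2 sqrt B\<close>, so this quadratic increases beyond \<open>sqrt B\<close>: it
  says that \<open>sqrt B\<close> is the larger of the two linear decay rates at speed \<open>c_nl\<close>. Hence \<open>r\<close> grows
  without bound, whereas \<open>r \<le> c\<close> for every front (\<open>monotone_front_speed_ge\<close>).
\<close>

section \<open>Peano's existence theorem\<close>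

text \<open>
  Tonelli's delayed equation: the right hand side at time \<open>s\<close> only sees the solution up to
  \<open>s - \<delta>\<close>. Hence each application of the integral operator makes its iterates exact on one more
  interval of length \<open>\<delta>\<close>, and finitely many iterations solve the equation on all of \<open>[a,b]\<close>.
\<close>

lemma delayed_integral_equation:
  fixes G :: "real \<times> 'a \<Rightarrow> 'a::euclidean_space"
  assumes ab: "a \<le> b" and contG: "continuous_on ({a..b} \<times> UNIV) G" and \<delta>: "0 < \<delta>"
  shows "\<exists>\<phi>. continuous_on {a..b} \<phi> \<and>
    (\<forall>t\<in>{a..b}. \<phi> t = y0 + integral {a..t} (\<lambda>s. G (s, \<phi> (max a (s - \<delta>)))))"
proof -
  define T where "T \<phi> t = y0 + integral {a..t} (\<lambda>s. G (s, \<phi> (max a (s - \<delta>))))" for \<phi> t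
  define \<phi> where "\<phi> k = (T ^^ k) (\<lambda>_. y0)" for k
  have Suc: "\<phi> (Suc k) = T (\<phi> k)" for k
    by (simp add: \<phi>_def)
  have delay_cont: "continuous_on {a..b} (\<lambda>s. G (s, \<psi> (max a (s - \<delta>))))"
    if "continuous_on {a..b} \<psi>" for \<psi>
  proof (intro continuous_on_compose2[OF contG] continuous_intros
      continuous_on_compose2[OF that])
    show "(\<lambda>s. max a (s - \<delta>)) ` {a..b} \<subseteq> {a..b}"
      using ab \<delta> by auto
  qed auto
  have cont: "continuous_on {a..b} (\<phi> k)" for k
  proof (induction k)
    case 0
    then show ?case by (simp add: \<phi>_def)
  next
    case (Suc k)
    have "continuous_on {a..b} (T (\<phi> k))"
      unfolding T_def
      by (intro continuous_intros indefinite_integral_continuous_1 integrable_continuous_real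
          delay_cont Suc)
    then show ?case by (simp add: \<open>\<And>k. \<phi> (Suc k) = T (\<phi> k)\<close>)
  qed
  have exact: "\<phi> (Suc k) t = \<phi> k t" if "t \<in> {a..b}" "t \<le> a + real k * \<delta>" for k t
    using that
  proof (induction k arbitrary: t)
    case 0
    then show ?case by (simp add: \<phi>_def T_def)
  next
    case (Suc k)
    have "integral {a..t} (\<lambda>s. G (s, \<phi> (Suc k) (max a (s - \<delta>)))) =
          integral {a..t} (\<lambda>s. G (s, \<phi> k (max a (s - \<delta>))))"
    proof (rule integral_cong)
      fix s assume s: "s \<in> {a..t}"
      have "max a (s - \<delta>) \<le> a + real k * \<delta>"
        using s Suc.prems \<delta> by (auto simp: algebra_simps)
      then show "G (s, \<phi> (Suc k) (max a (s - \<delta>))) = G (s, \<phi> k (max a (s - \<delta>)))"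
        using s Suc.prems \<delta> by (subst Suc.IH) auto
    qed
    then have "T (\<phi> (Suc k)) t = T (\<phi> k) t"
      by (simp add: T_def)
    then show ?case by (simp only: \<open>\<And>k. \<phi> (Suc k) = T (\<phi> k)\<close>)
  qed
  obtain k :: nat where k: "(b - a) / \<delta> < real k"
    using reals_Archimedean2 by blast
  have "\<phi> k t = T (\<phi> k) t" if "t \<in> {a..b}" for t
  proof -
    have "t \<le> a + real k * \<delta>"
      using that k \<delta> by (auto simp: field_simps)
    then show ?thesis
      using exact[OF that, of k] by (simp only: Suc)
  qed
  then show ?thesis
    using cont[of k] unfolding T_def by blast
qed

text \<open>
  Peano's theorem for a bounded right hand side. The solutions of the delayed equations are
  uniformly Lipschitz, so a subsequence converges as the delay tends to zero.
\<close>

theorem Peano_existence: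
  fixes G :: "real \<times> 'a \<Rightarrow> 'a::euclidean_space"
  assumes ab: "a \<le> b" and contG: "continuous_on ({a..b} \<times> UNIV) G"
    and bound: "\<And>t y. t \<in> {a..b} \<Longrightarrow> norm (G (t, y)) \<le> M"
  obtains y where "y a = y0"
    "\<And>t. t \<in> {a..b} \<Longrightarrow> (y has_vector_derivative G (t, y t)) (at t within {a..b})"
proof -
  define \<delta> where "\<delta> n = inverse (real (Suc n))" for n
  have \<delta>_pos: "0 < \<delta> n" for n by (simp add: \<delta>_def)
  have \<delta>_lim: "\<delta> \<longlonglongrightarrow> 0"
    unfolding \<delta>_def by (rule LIMSEQ_inverse_real_of_nat)
  have M0: "0 \<le> M"
    using bound[of a undefined] ab norm_ge_zero order_trans by (metis atLeastAtMost_iff order_refl)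
  obtain \<phi> where cont: "\<And>n. continuous_on {a..b} (\<phi> n)"
    and eq: "\<And>n t. t \<in> {a..b} \<Longrightarrow>
      \<phi> n t = y0 + integral {a..t} (\<lambda>s. G (s, \<phi> n (max a (s - \<delta> n))))"
    using delayed_integral_equation[OF ab contG \<delta>_pos] by metis
  define g where "g n = (\<lambda>s. G (s, \<phi> n (max a (s - \<delta> n))))" for n
  have g_cont: "continuous_on {a..b} (g n)" for n
    unfolding g_def
  proof (intro continuous_on_compose2[OF contG] continuous_intros continuous_on_compose2[OF cont])
    show "(\<lambda>s. max a (s - \<delta> n)) ` {a..b} \<subseteq> {a..b}"
      using ab \<delta>_pos[of n] by (auto simp: max_def less_imp_le intro: order_trans)
  qed auto
  have g_int: "g n integrable_on {s..t}" if "a \<le> s" "t \<le> b" for n s t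
    using that by (intro integrable_continuous_real continuous_on_subset[OF g_cont]) auto
  have lip_ordered: "norm (\<phi> n t - \<phi> n s) \<le> M * (t - s)" if "a \<le> s" "s \<le> t" "t \<le> b" for n s t
  proof -
    have "\<phi> n t - \<phi> n s = integral {a..t} (g n) - integral {a..s} (g n)"
      using that eq[of t n] eq[of s n] by (simp add: g_def)
    also have "\<dots> = integral {s..t} (g n)"
      using Henstock_Kurzweil_Integration.integral_combine[OF that(1,2) g_int[of a t n]] that
      by (simp add: algebra_simps)
    finally show ?thesis
      using integral_bound[OF that(2) continuous_on_subset[OF g_cont[of n]], of M] that bound
      by (auto simp: g_def)
  qed
  have lip: "norm (\<phi> n t - \<phi> n s) \<le> M * \<bar>t - s\<bar>" if "s \<in> {a..b}" "t \<in> {a..b}" for n s t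
    using lip_ordered[of s t n] lip_ordered[of t s n] that
    by (cases "s \<le> t") (auto simp: norm_minus_commute)
  have \<phi>_a: "\<phi> n a = y0" for n
    using eq[of a n] ab by simp
  obtain y k where y_cont: "continuous_on {a..b} y" and k: "strict_mono (k :: nat \<Rightarrow> nat)"
    and unif: "\<And>e. 0 < e \<Longrightarrow> \<exists>N. \<forall>n x. n \<ge> N \<and> x \<in> {a..b} \<longrightarrow> norm (\<phi> (k n) x - y x) < e"
  proof (rule Arzela_Ascoli[of "{a..b}" \<phi> "norm y0 + M * (b - a)"])
    show "norm (\<phi> n x) \<le> norm y0 + M * (b - a)" if "x \<in> {a..b}" for n x
    proof -
      have "norm (\<phi> n x - y0) \<le> M * (x - a)"
        using lip_ordered[of a x n] that \<phi>_a by simp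
      also have "\<dots> \<le> M * (b - a)"
        using that M0 by (intro mult_left_mono) auto
      finally show ?thesis
        using norm_triangle_sub[of "\<phi> n x" y0] by linarith
    qed
    show "\<exists>d>0. \<forall>n y. y \<in> {a..b} \<and> norm (x - y) < d \<longrightarrow> norm (\<phi> n x - \<phi> n y) < e"
      if "x \<in> {a..b}" "0 < e" for x e
    proof (intro exI conjI allI impI)
      show "0 < e / (M + 1)" using M0 that by simp
      fix n y assume y: "y \<in> {a..b} \<and> norm (x - y) < e / (M + 1)"
      have "norm (\<phi> n x - \<phi> n y) \<le> M * \<bar>x - y\<bar>"
        using lip y that by blast
      also have "\<dots> \<le> (M + 1) * \<bar>x - y\<bar>"
        by (intro mult_right_mono) auto
      also have "\<dots> < e"
        using y M0 by (simp add: field_simps)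
      finally show "norm (\<phi> n x - \<phi> n y) < e" .
    qed
  qed auto
  have lim: "(\<lambda>n. \<phi> (k n) t) \<longlonglongrightarrow> y t" if "t \<in> {a..b}" for t
  proof (rule LIMSEQ_I)
    show "\<exists>N. \<forall>n\<ge>N. norm (\<phi> (k n) t - y t) < e" if "0 < e" for e
      using unif[OF that] \<open>t \<in> {a..b}\<close> by blast
  qed
  have \<delta>k: "(\<lambda>n. \<delta> (k n)) \<longlonglongrightarrow> 0"
    using LIMSEQ_subseq_LIMSEQ[OF \<delta>_lim k] by (simp add: o_def)
  have g_lim: "(\<lambda>n. g (k n) s) \<longlonglongrightarrow> G (s, y s)" if s: "s \<in> {a..b}" for s
  proof -
    have "(\<lambda>n. \<phi> (k n) (max a (s - \<delta> (k n))) - \<phi> (k n) s) \<longlonglongrightarrow> 0"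
    proof (rule Lim_null_comparison)
      show "\<forall>\<^sub>F n in sequentially.
          norm (\<phi> (k n) (max a (s - \<delta> (k n))) - \<phi> (k n) s) \<le> M * \<delta> (k n)"
      proof (rule always_eventually, rule allI)
        fix n
        have mem: "max a (s - \<delta> (k n)) \<in> {a..b}"
          using s \<delta>_pos[of "k n"] by auto
        have "norm (\<phi> (k n) (max a (s - \<delta> (k n))) - \<phi> (k n) s) \<le> M * \<bar>max a (s - \<delta> (k n)) - s\<bar>"
          by (rule lip[OF s mem])
        also have "\<dots> \<le> M * \<delta> (k n)"
          using s \<delta>_pos[of "k n"] M0 by (intro mult_left_mono) auto
        finally show "norm (\<phi> (k n) (max a (s - \<delta> (k n))) - \<phi> (k n) s) \<le> M * \<delta> (k n)" .
      qed
      show "(\<lambda>n. M * \<delta> (k n)) \<longlonglongrightarrow> 0"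
        using tendsto_mult_right_zero[OF \<delta>k] by simp
    qed
    from tendsto_add[OF this lim[OF s]]
    have "(\<lambda>n. \<phi> (k n) (max a (s - \<delta> (k n)))) \<longlonglongrightarrow> y s" by simp
    then have "(\<lambda>n. (s, \<phi> (k n) (max a (s - \<delta> (k n))))) \<longlonglongrightarrow> (s, y s)"
      by (intro tendsto_intros)
    then show ?thesis
      unfolding g_def using s
      by (intro continuous_on_tendsto_compose[OF contG]) auto
  qed
  have G_cont: "continuous_on {a..b} (\<lambda>s. G (s, y s))"
    by (intro continuous_on_compose2[OF contG] continuous_intros y_cont) auto
  have y_eq: "y t = y0 + integral {a..t} (\<lambda>s. G (s, y s))" if t: "t \<in> {a..b}" for t
  proof (rule LIMSEQ_unique[OF lim[OF t]])
    have "(\<lambda>n. integral {a..t} (g (k n))) \<longlonglongrightarrow> integral {a..t} (\<lambda>s. G (s, y s))"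
    proof (rule dominated_convergence(2)[where h = "\<lambda>_. M"])
      show "norm (g (k n) x) \<le> M" if "x \<in> {a..t}" for n x
        using bound that t by (auto simp: g_def)
      show "(\<lambda>n. g (k n) x) \<longlonglongrightarrow> G (x, y x)" if "x \<in> {a..t}" for x
        using g_lim that t by auto
      show "g (k n) integrable_on {a..t}" for n
        using g_int t by auto
    qed (rule integrable_const_ivl)
    then have "(\<lambda>n. y0 + integral {a..t} (g (k n))) \<longlonglongrightarrow> y0 + integral {a..t} (\<lambda>s. G (s, y s))"
      by (intro tendsto_intros)
    then show "(\<lambda>n. \<phi> (k n) t) \<longlonglongrightarrow> y0 + integral {a..t} (\<lambda>s. G (s, y s))"
      using eq[OF t] by (simp add: g_def)
  qed
  show ?thesis
  proof (rule that)
    show "y a = y0" using y_eq[of a] ab by simp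
    fix t assume t: "t \<in> {a..b}"
    have "((\<lambda>t. y0 + integral {a..t} (\<lambda>s. G (s, y s))) has_vector_derivative G (t, y t))
        (at t within {a..b})"
      using has_vector_derivative_add[OF has_vector_derivative_const
          integral_has_vector_derivative[OF G_cont t]] by simp
    then show "(y has_vector_derivative G (t, y t)) (at t within {a..b})"
      by (rule has_vector_derivative_transform[rotated 2]) (use y_eq t in auto)
  qed
qed

section \<open>Scalar tools\<close>

text \<open>
  The barrier argument: a function that can only decrease where it is nonpositive never gets
  there from a positive value. At the first time at which it reaches a positive level below
  \<open>\<phi> a\<close> it would have been nondecreasing up to then.
\<close>

lemma le_of_deriv_nonneg_while_pos:
  fixes \<phi> :: "real \<Rightarrow> real"
  assumes ab: "a \<le> b"
    and der: "\<And>x. x \<in> {a..b} \<Longrightarrow> (\<phi> has_real_derivative \<phi>' x) (at x within {a..b})"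
    and nonneg: "\<And>x. x \<in> {a..b} \<Longrightarrow> 0 < \<phi> x \<Longrightarrow> 0 \<le> \<phi>' x"
    and pos: "0 < \<phi> a"
  shows "\<phi> a \<le> \<phi> b"
proof (rule ccontr)
  assume "\<not> \<phi> a \<le> \<phi> b"
  then obtain l where l: "max (\<phi> b) 0 < l" "l < \<phi> a"
    using pos dense[of "max (\<phi> b) 0" "\<phi> a"] by (auto simp: not_le)
  have cont: "continuous_on {a..b} \<phi>"
    using der DERIV_continuous_on by blast
  define S where "S = {x \<in> {a..b}. \<phi> x \<le> l}"
  have "closed S"
    unfolding S_def using cont by (intro continuous_on_closed_Collect_le) (auto intro: continuous_intros)
  then have "compact S"
    unfolding S_def by (auto simp: S_def compact_eq_bounded_closed intro: bounded_subset[OF bounded_closed_interval[of a b]])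
  moreover have "b \<in> S" using l ab by (auto simp: S_def)
  ultimately obtain t where t: "t \<in> S" "\<And>x. x \<in> S \<Longrightarrow> t \<le> x"
    using compact_attains_inf[of S] by (metis empty_iff)
  have tb: "a \<le> t" "t \<le> b" "\<phi> t \<le> l" using t by (auto simp: S_def)
  have "\<phi> a \<le> \<phi> t"
  proof (rule DERIV_nonneg_imp_increasing_open[OF tb(1)])
    fix x assume x: "a < x" "x < t"
    then have "x \<notin> S" using t(2)[of x] by auto
    then have "0 < \<phi> x" using x tb l by (simp add: S_def)
    then have "0 \<le> \<phi>' x" using x tb by (intro nonneg) auto
    moreover have "(\<phi> has_real_derivative \<phi>' x) (at x)"
      using der[of x] x tb by (simp add: at_within_Icc_at)
    ultimately show "\<exists>y. (\<phi> has_real_derivative y) (at x) \<and> 0 \<le> y" by blast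
  next
    show "continuous_on {a..t} \<phi>" using cont tb by (auto intro: continuous_on_subset)
  qed
  then show False using tb l by simp
qed

lemma linear_bound_at_zero:
  fixes g :: "real \<Rightarrow> real"
  assumes S: "compact S" and cont: "continuous_on S g"
    and der: "(g has_real_derivative D) (at x0 within S)" and zero: "g x0 = 0"
  obtains K where "0 < K" "\<And>x. x \<in> S \<Longrightarrow> \<bar>g x\<bar> \<le> K * \<bar>x - x0\<bar>"
proof -
  have "((\<lambda>x. \<bar>g x / (x - x0)\<bar>) \<longlongrightarrow> \<bar>D\<bar>) (at x0 within S)"
    using der zero by (intro tendsto_rabs) (simp add: has_field_derivative_iff)
  then have "\<forall>\<^sub>F x in at x0 within S. \<bar>g x / (x - x0)\<bar> < \<bar>D\<bar> + 1"
    by (rule order_tendstoD) simp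
  then obtain d where d: "0 < d"
    "\<And>x. x \<in> S \<Longrightarrow> x \<noteq> x0 \<Longrightarrow> dist x x0 < d \<Longrightarrow> \<bar>g x / (x - x0)\<bar> < \<bar>D\<bar> + 1"
    unfolding eventually_at by blast
  have "bounded (g ` S)"
    using compact_continuous_image[OF cont S] by (rule compact_imp_bounded)
  then obtain M where M: "0 < M" "\<And>x. x \<in> S \<Longrightarrow> \<bar>g x\<bar> \<le> M"
    unfolding bounded_pos by auto
  have bound: "\<bar>g x\<bar> \<le> (\<bar>D\<bar> + 1 + M / d) * \<bar>x - x0\<bar>" if x: "x \<in> S" for x
  proof (cases "dist x x0 < d")
    case True
    have "\<bar>g x\<bar> \<le> (\<bar>D\<bar> + 1) * \<bar>x - x0\<bar>"
    proof (cases "x = x0")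
      case False
      then show ?thesis using d(2)[OF x False True] by (simp add: field_simps)
    qed (simp add: zero)
    also have "\<dots> \<le> (\<bar>D\<bar> + 1 + M / d) * \<bar>x - x0\<bar>"
      using M d by (intro mult_right_mono) auto
    finally show ?thesis .
  next
    case False
    have "\<bar>g x\<bar> \<le> M / d * d" using M(2)[OF x] d by simp
    also have "\<dots> \<le> (\<bar>D\<bar> + 1 + M / d) * \<bar>x - x0\<bar>"
      using False M d by (intro mult_mono) (auto simp: dist_real_def)
    finally show ?thesis .
  qed
  show ?thesis
    using that[OF _ bound] M d by (simp add: add_nonneg_pos)
qed

text \<open>
  Separation of variables: \<open>U\<close> is the inverse of \<open>- F\<close>, where \<open>F\<close> is an antiderivative of \<open>1 / p\<close>.
  The linear bounds on \<open>p\<close> make \<open>F\<close> diverge at least logarithmically at \<open>0\<close> and at \<open>1\<close>, so that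
  \<open>U\<close> is defined on the whole line.
\<close>

lemma decreasing_profile_exists:
  fixes p :: "real \<Rightarrow> real"
  assumes cont: "continuous_on {0<..<1} p"
    and pos: "\<And>u. 0 < u \<Longrightarrow> u < 1 \<Longrightarrow> 0 < p u"
    and K: "0 < K"
    and le0: "\<And>u. 0 < u \<Longrightarrow> u < 1 \<Longrightarrow> p u \<le> K * u"
    and le1: "\<And>u. 0 < u \<Longrightarrow> u < 1 \<Longrightarrow> p u \<le> K * (1 - u)"
  obtains U where "\<And>z. 0 < U z" "\<And>z. U z < 1"
    "\<And>z. (U has_real_derivative - p (U z)) (at z)"
    "antimono U" "(U \<longlongrightarrow> 1) at_bot" "(U \<longlongrightarrow> 0) at_top"
proof -
  have isCont: "isCont (\<lambda>u. 1 / p u) u" if "0 < u" "u < 1" for u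
  proof -
    have "isCont p u"
      using cont that by (simp add: continuous_on_eq_continuous_at)
    then show ?thesis
      using pos[OF that] by (intro continuous_intros) auto
  qed
  have "\<exists>F. \<forall>x :: real. ereal 0 < x \<longrightarrow> x < ereal 1 \<longrightarrow> (F has_vector_derivative 1 / p x) (at x)"
    by (rule einterval_antiderivative) (use isCont in auto)
  then obtain F where F: "\<And>u. 0 < u \<Longrightarrow> u < 1 \<Longrightarrow> (F has_real_derivative 1 / p u) (at u)"
    by (auto simp: has_real_derivative_iff_has_vector_derivative)
  have F_less: "F u < F v" if "0 < u" "u < v" "v < 1" for u v
  proof (rule DERIV_pos_imp_increasing[OF that(2)])
    fix x assume x: "u \<le> x" "x \<le> v"
    then show "\<exists>y. (F has_real_derivative y) (at x) \<and> 0 < y"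
      using F[of x] pos[of x] that by (intro exI[of _ "1 / p x"]) auto
  qed
  have F_inj: "u = v" if "F u = F v" "0 < u" "u < 1" "0 < v" "v < 1" for u v
    using F_less[of u v] F_less[of v u] that by linarith
  have F_low: "F u \<le> F (1/2) + (ln u - ln (1/2)) / K" if u: "0 < u" "u \<le> 1/2" for u
  proof -
    have "F u - ln u / K \<le> F (1/2) - ln (1/2) / K"
    proof (rule DERIV_nonneg_imp_nondecreasing[OF u(2)])
      fix x assume x: "u \<le> x" "x \<le> 1/2"
      then have "((\<lambda>u. F u - ln u / K) has_real_derivative 1 / p x - 1 / x / K) (at x)"
        using u by (intro DERIV_diff DERIV_cdivide F DERIV_ln_divide) auto
      moreover have "1 / x / K \<le> 1 / p x"
        using le0[of x] pos[of x] x u by (simp add: divide_left_mono mult.commute)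
      ultimately show "\<exists>y. ((\<lambda>u. F u - ln u / K) has_real_derivative y) (at x) \<and> 0 \<le> y"
        by force
    qed
    then show ?thesis by (simp add: diff_divide_distrib)
  qed
  have F_high: "F (1/2) + (ln (1/2) - ln (1 - u)) / K \<le> F u" if u: "1/2 \<le> u" "u < 1" for u
  proof -
    have "F (1/2) + ln (1 - 1/2) / K \<le> F u + ln (1 - u) / K"
    proof (rule DERIV_nonneg_imp_nondecreasing[OF u(1)])
      fix x assume x: "1/2 \<le> x" "x \<le> u"
      have "((\<lambda>u. ln (1 - u)) has_real_derivative - (1 / (1 - x))) (at x)"
        using x u by (auto intro!: derivative_eq_intros)
      then have "((\<lambda>u. F u + ln (1 - u) / K) has_real_derivative 1 / p x + - (1 / (1 - x)) / K) (at x)"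
        using x u by (intro DERIV_add DERIV_cdivide F) auto
      moreover have "1 / (1 - x) / K \<le> 1 / p x"
        using le1[of x] pos[of x] x u by (simp add: divide_left_mono mult.commute)
      ultimately show "\<exists>y. ((\<lambda>u. F u + ln (1 - u) / K) has_real_derivative y) (at x) \<and> 0 \<le> y"
        by force
    qed
    then show ?thesis by (simp add: diff_divide_distrib)
  qed
  have surj: "\<exists>u. 0 < u \<and> u < 1 \<and> F u = y" for y
  proof -
    \<comment> \<open>The logarithmic bounds on \<open>F\<close>, solved for the argument, place \<open>y\<close> between two values of \<open>F\<close>.\<close>
    define a where "a = min (1/2) (exp (K * (y - F (1/2)) + ln (1/2)))"
    define b where "b = 1 - min (1/2) (exp (K * (F (1/2) - y) + ln (1/2)))"
    have a: "0 < a" "a \<le> 1/2" and b: "1/2 \<le> b" "b < 1"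
      by (auto simp: a_def b_def)
    have "ln a \<le> ln (exp (K * (y - F (1/2)) + ln (1/2)))"
      using a by (subst ln_le_cancel_iff) (auto simp: a_def)
    then have "(ln a - ln (1/2)) / K \<le> y - F (1/2)"
      using K by (simp add: pos_divide_le_eq mult.commute)
    then have Fa: "F a \<le> y" using F_low[OF a] by linarith
    have "ln (1 - b) \<le> ln (exp (K * (F (1/2) - y) + ln (1/2)))"
      using b by (subst ln_le_cancel_iff) (auto simp: b_def)
    then have "y - F (1/2) \<le> (ln (1/2) - ln (1 - b)) / K"
      using K by (subst pos_le_divide_eq) (simp_all add: algebra_simps)
    then have Fb: "y \<le> F b" using F_high[OF b] by linarith
    have "\<exists>x\<ge>a. x \<le> b \<and> F x = y"
    proof (rule IVT[of F, OF Fa Fb])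
      show "\<forall>x. a \<le> x \<and> x \<le> b \<longrightarrow> isCont F x"
        using a b by (auto intro: DERIV_isCont[OF F])
    qed (use a b in auto)
    then obtain x where "a \<le> x" "x \<le> b" "F x = y" by blast
    then show ?thesis using a b by (intro exI[of _ x]) auto
  qed
  define U where "U z = (SOME u. 0 < u \<and> u < 1 \<and> F u = - z)" for z
  have U: "0 < U z" "U z < 1" "F (U z) = - z" for z
    using someI_ex[OF surj[of "- z"]] by (auto simp: U_def)
  have U_F: "U (- F u) = u" if "0 < u" "u < 1" for u
    using F_inj[of "U (- F u)" u] U[of "- F u"] that by simp
  have U_cont: "isCont U z" for z
  proof -
    have "isCont U (- F (U z))"
    proof (rule isCont_inverse_function2[where f = "\<lambda>u. - F u" and x = "U z" and a = "U z / 2" and b = "(1 + U z) / 2"])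
      show "isCont (\<lambda>u. - F u) u" if "U z / 2 \<le> u" "u \<le> (1 + U z) / 2" for u
        using that U[of z] by (intro continuous_intros DERIV_isCont[OF F]) auto
      show "U (- F u) = u" if "U z / 2 \<le> u" "u \<le> (1 + U z) / 2" for u
        using that U[of z] by (intro U_F) auto
    qed (use U[of z] in auto)
    then show ?thesis using U(3)[of z] by simp
  qed
  have U_der: "(U has_real_derivative - p (U z)) (at z)" for z
  proof -
    have "(U has_real_derivative inverse (- (1 / p (U z)))) (at z)"
    proof (rule DERIV_inverse_function[where f = "\<lambda>u. - F u" and a = "z - 1" and b = "z + 1"])
      show "((\<lambda>u. - F u) has_real_derivative - (1 / p (U z))) (at (U z))"
        by (intro DERIV_minus F U)
    qed (use U U_cont pos[OF U(1,2), of z] in auto)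
    then show ?thesis by simp
  qed
  have "antimono U"
  proof (rule antimonoI)
    fix x y :: real assume "x \<le> y"
    then show "U y \<le> U x"
      using F_less[of "U x" "U y"] U by (metis linorder_not_less neg_less_iff_less)
  qed
  moreover have "(U \<longlongrightarrow> 1) at_bot"
  proof (rule order_tendstoI)
    fix l :: real assume "l < 1"
    define l' where "l' = max l (1/2)"
    have "\<forall>\<^sub>F z in at_bot. z < - F l'" by (rule eventually_gt_at_bot)
    then show "\<forall>\<^sub>F z in at_bot. l < U z"
    proof eventually_elim
      case (elim z)
      then have "F l' < F (U z)" using U(3)[of z] by simp
      then have "\<not> U z \<le> l'"
        using F_less[of "U z" l'] U[of z] \<open>l < 1\<close> by (fastforce simp: l'_def order_le_less)
      then show ?case by (simp add: l'_def)
    qed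
  qed (use U(2) order.strict_trans in \<open>auto intro!: always_eventually\<close>)
  moreover have "(U \<longlongrightarrow> 0) at_top"
  proof (rule order_tendstoI)
    fix l :: real assume "0 < l"
    define l' where "l' = min l (1/2)"
    have "\<forall>\<^sub>F z in at_top. - F l' < z" by (rule eventually_gt_at_top)
    then show "\<forall>\<^sub>F z in at_top. U z < l"
    proof eventually_elim
      case (elim z)
      then have "F (U z) < F l'" using U(3)[of z] by simp
      then have "\<not> l' \<le> U z"
        using F_less[of l' "U z"] U[of z] \<open>0 < l\<close> by (fastforce simp: l'_def order_le_less)
      then show ?case by (simp add: l'_def)
    qed
  qed (use U(1) order.strict_trans in \<open>auto intro!: always_eventually\<close>)
  ultimately show ?thesis
    using that U U_der by blast
qed

section \<open>Nonlinearities of solvable type\<close>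

locale solvable_monostable =
  fixes f :: "real \<Rightarrow> real \<Rightarrow> real" and \<beta> :: real and h h' :: "real \<Rightarrow> real" and A B :: real
  assumes h_deriv: "u \<in> {0..1} \<Longrightarrow> (h has_real_derivative h' u) (at u within {0..1})"
    and h_0: "h 0 = 0" and h_1: "h 1 = 0"
    and h_nonneg: "u \<in> {0..1} \<Longrightarrow> 0 \<le> h u"
    and h'_0: "h' 0 = 1"
    and A_pos: "0 < A" and B_pos: "0 < B"
    and f_eq: "u \<in> {0..1} \<Longrightarrow> f u \<beta> = h u * (A - B * h' u)"
    and f_pos: "0 < u \<Longrightarrow> u < 1 \<Longrightarrow> 0 < f u \<beta>"
    and f_deriv_0: "\<exists>D. ((\<lambda>u. f u \<beta>) has_real_derivative D) (at 0 within {0..1})"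
begin

lemma h_cont: "continuous_on {0..1} h"
  using h_deriv DERIV_continuous_on by blast

lemma h_pos: "0 < h u" if "0 < u" "u < 1"
  using f_pos[OF that] f_eq[of u] h_nonneg[of u] that by (cases "h u = 0") auto

lemma f_0: "f 0 \<beta> = 0"
  using f_eq[of 0] h_0 by simp

lemma f_nonneg: "0 \<le> f u \<beta>" if "u \<in> {0..1}"
  using f_pos[of u] f_eq[of u] h_0 h_1 that
  by (cases "u = 0 \<or> u = 1") auto

lemma h_quotient_tendsto: "((\<lambda>u. h u / u) \<longlongrightarrow> 1) (at_right 0)"
  using h_deriv[of 0] h_0 h'_0 by (simp add: has_field_derivative_iff at_within_Icc_at_right)

text \<open>
  This is \<open>f' 0 = A - B h' 0\<close>, which is not immediate since \<open>h'\<close> need not be continuous. But the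
  derivative of \<open>f\<close> at \<open>0\<close> makes \<open>h' = (A - f / h) / B\<close> converge at \<open>0\<close>, and a derivative that
  converges does so to its value, here by l'Hopital's rule applied to \<open>h u / u\<close>.
\<close>

lemma f_quotient_tendsto: "((\<lambda>u. f u \<beta> / u) \<longlongrightarrow> A - B) (at_right 0)"
proof -
  obtain D where "((\<lambda>u. f u \<beta>) has_real_derivative D) (at 0 within {0..1})"
    using f_deriv_0 by blast
  then have D: "((\<lambda>u. f u \<beta> / u) \<longlongrightarrow> D) (at_right 0)"
    using f_0 by (simp add: has_field_derivative_iff at_within_Icc_at_right)
  have near: "\<forall>\<^sub>F u in at_right (0::real). 0 < u \<and> u < 1"
    using eventually_at_right_real[of 0 "1::real"] by (simp add: eventually_mono)
  have "((\<lambda>u. (A - (f u \<beta> / u) / (h u / u)) / B) \<longlongrightarrow> (A - D / 1) / B) (at_right 0)"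
    using B_pos by (intro tendsto_intros D h_quotient_tendsto) auto
  moreover have "\<forall>\<^sub>F u in at_right 0. (A - (f u \<beta> / u) / (h u / u)) / B = h' u"
    using near
  proof eventually_elim
    case (elim u)
    then show ?case using f_eq[of u] h_pos[of u] B_pos by (simp add: field_simps)
  qed
  ultimately have h'_lim: "(h' \<longlongrightarrow> (A - D) / B) (at_right 0)"
    by (simp add: Lim_transform_eventually)
  have "((\<lambda>u. h u / u) \<longlongrightarrow> (A - D) / B) (at_right 0)"
  proof (rule lhopital_right_0[where f' = h' and g' = "\<lambda>_. 1"])
    show "(h \<longlongrightarrow> 0) (at_right 0)"
      using h_cont h_0 unfolding continuous_on_def
      by (metis at_within_Icc_at_right atLeastAtMost_iff order_refl zero_le_one zero_less_one)
    show "\<forall>\<^sub>F u in at_right 0. (h has_real_derivative h' u) (at u)"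
      using near
    proof eventually_elim
      case (elim u)
      then show ?case using h_deriv[of u] by (simp add: at_within_Icc_at)
    qed
    show "\<forall>\<^sub>F u in at_right 0. u \<noteq> (0::real)"
      using near by eventually_elim auto
  qed (use h'_lim in \<open>auto intro: tendsto_eq_intros\<close>)
  from tendsto_unique[OF _ this h_quotient_tendsto] have "(A - D) / B = 1" by simp
  then have "D = A - B" using B_pos by (simp add: field_simps)
  then show ?thesis using D by simp
qed

section \<open>Fronts of speed at least \<open>A / sqrt B\<close>\<close>

text \<open>
  The unstable trajectory of the state \<open>u = 1\<close>, in the unknown \<open>w = p\<^sup>2 - B h\<^sup>2\<close>. It stays below
  the explicit trajectory \<open>w = 0\<close>, because at \<open>w = 0\<close> the slope \<open>2 (c sqrt B - A) h\<close> is
  nonnegative and \<open>u\<close> runs from \<open>1\<close> downwards. It stays above \<open>p = 0\<close>, because there the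
  derivative of \<open>p\<^sup>2\<close> is \<open>- 2 f < 0\<close>, so \<open>p\<^sup>2\<close> has no interior minimum with value \<open>0\<close>.
\<close>

lemma trajectory_exists:
  assumes c: "A \<le> c * sqrt B"
  obtains w where
    "\<And>u. 0 < u \<Longrightarrow> u < 1 \<Longrightarrow>
       (w has_real_derivative 2 * (c * sqrt (w u + B * (h u)\<^sup>2) - A * h u)) (at u)"
    "\<And>u. 0 < u \<Longrightarrow> u < 1 \<Longrightarrow> w u \<le> 0"
    "\<And>u. 0 < u \<Longrightarrow> u < 1 \<Longrightarrow> 0 < w u + B * (h u)\<^sup>2"
proof -
  have c_pos: "0 < c"
    using c A_pos B_pos by (smt (verit) mult_nonpos_nonneg real_sqrt_ge_zero)
  \<comment> \<open>Truncating \<open>y\<close> at \<open>0\<close> and the radicand at \<open>0\<close> makes the right hand side bounded and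
    everywhere defined; both truncations turn out to be inactive on \<open>(0,1)\<close>.\<close>
  define S where "S u y = sqrt (max 0 (min y 0 + B * (h u)\<^sup>2))" for u y
  define R where "R u y = 2 * (c * S u y - A * h u)" for u y
  have S_le: "S u y \<le> sqrt B * h u" if "u \<in> {0..1}" for u y
  proof -
    have "S u y \<le> sqrt (B * (h u)\<^sup>2)"
      unfolding S_def using B_pos by (intro real_sqrt_le_mono) auto
    then show ?thesis using h_nonneg[OF that] by (simp add: real_sqrt_mult)
  qed
  have S_nonneg: "0 \<le> S u y" for u y by (simp add: S_def)
  obtain m where m: "\<And>u. u \<in> {0..1} \<Longrightarrow> h u \<le> m"
    using continuous_attains_sup[of "{0..1}" h] h_cont by force
  have flip: "1 - u \<in> {0..1}" if "u \<in> {0..1}" for u :: real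
    using that by auto
  have "continuous_on ({0..1} \<times> UNIV) (\<lambda>(t, y). - R (1 - t) y)"
    unfolding R_def S_def case_prod_unfold
    by (intro continuous_intros continuous_on_compose2[OF h_cont]) auto
  moreover have "norm ((\<lambda>(t, y). - R (1 - t) y) (t, y)) \<le> 2 * (c * (sqrt B * m) + A * m)"
    if t: "t \<in> {0..1}" for t y
  proof -
    have "c * S (1 - t) y \<le> c * (sqrt B * h (1 - t))"
      using c_pos S_le[OF flip[OF t]] by (intro mult_left_mono) auto
    also have "\<dots> \<le> c * (sqrt B * m)"
      using c_pos B_pos m[OF flip[OF t]] by (intro mult_left_mono) auto
    finally have 1: "c * S (1 - t) y \<le> c * (sqrt B * m)" .
    have 2: "A * h (1 - t) \<le> A * m"
      using A_pos m[OF flip[OF t]] by (intro mult_left_mono) auto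
    have "0 \<le> c * S (1 - t) y" "0 \<le> A * h (1 - t)"
      using c_pos A_pos S_nonneg h_nonneg[OF flip[OF t]] by auto
    with 1 2 show ?thesis by (simp add: R_def abs_le_iff)
  qed
  ultimately obtain v where v0: "v 0 = 0" and v: "\<And>t. t \<in> {0..1} \<Longrightarrow>
      (v has_vector_derivative - R (1 - t) (v t)) (at t within {0..1})"
    using Peano_existence[of 0 1 "\<lambda>(t, y). - R (1 - t) y" "2 * (c * (sqrt B * m) + A * m)" 0]
    by (metis (no_types, lifting) case_prod_conv zero_le_one)
  \<comment> \<open>Peano's theorem runs forward in \<open>t = 1 - u\<close>.\<close>
  define w where "w u = v (1 - u)" for u
  have w_1: "w 1 = 0" by (simp add: w_def v0)
  have w: "(w has_real_derivative R u (w u)) (at u within {0..1})" if u: "u \<in> {0..1}" for u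
  proof -
    have "(v has_real_derivative - R u (w u)) (at (1 - u) within {0..1})"
      using v[OF flip[OF u]] by (simp add: has_real_derivative_iff_has_vector_derivative w_def)
    then have "(v has_real_derivative - R u (w u)) (at (1 - u) within (\<lambda>u. 1 - u) ` {0..1})"
      by (rule DERIV_subset) auto
    moreover have "((\<lambda>u. 1 - u) has_real_derivative - 1) (at u within {0..1})"
      by (auto intro!: derivative_eq_intros)
    ultimately have "(v \<circ> (\<lambda>u. 1 - u) has_real_derivative - R u (w u) * - 1) (at u within {0..1})"
      by (rule DERIV_image_chain)
    then show ?thesis by (simp add: w_def[abs_def] o_def)
  qed
  have w_le: "w u \<le> 0" if u: "u \<in> {0..1}" for u
  proof (rule ccontr)
    assume "\<not> w u \<le> 0"
    then have "0 < w u" by simp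
    have "w u \<le> w 1"
    proof (rule le_of_deriv_nonneg_while_pos[where \<phi> = w and \<phi>' = "\<lambda>x. R x (w x)"])
      show "(w has_real_derivative R x (w x)) (at x within {u..1})" if "x \<in> {u..1}" for x
        using w[of x] that u by (auto intro: DERIV_subset)
      show "0 \<le> R x (w x)" if x: "x \<in> {u..1}" and "0 < w x" for x
      proof -
        have x01: "x \<in> {0..1}" using x u by auto
        have "S x (w x) = sqrt B * h x"
          using \<open>0 < w x\<close> B_pos h_nonneg[OF x01] by (simp add: S_def real_sqrt_mult)
        moreover have "A * h x \<le> c * sqrt B * h x"
          using c h_nonneg[OF x01] by (rule mult_right_mono)
        ultimately show ?thesis by (simp add: R_def mult.assoc)
      qed
    qed (use u \<open>0 < w u\<close> in auto)
    then show False using \<open>0 < w u\<close> w_1 by simp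
  qed
  \<comment> \<open>\<open>g\<close> is \<open>p\<^sup>2\<close>, with derivative \<open>- 2 f\<close> wherever \<open>g \<le> 0\<close>.\<close>
  define g where "g u = w u + B * (h u)\<^sup>2" for u
  have g: "(g has_real_derivative R u (w u) + 2 * B * h u * h' u) (at u within {0..1})"
    if u: "u \<in> {0..1}" for u
    unfolding g_def using w[OF u] h_deriv[OF u] by (auto intro!: derivative_eq_intros)
  have g_cont: "continuous_on {0..1} g"
    by (rule DERIV_continuous_on[OF g])
  have g_pos: "0 < g u" if u: "0 < u" "u < 1" for u
  proof (rule ccontr)
    assume "\<not> 0 < g u"
    have not_min: "\<exists>y\<in>{u..1}. g y < g x" if x: "u \<le> x" "x < 1" "g x \<le> 0" for x
    proof -
      have x01: "x \<in> {0..1}" "0 < x" using x u by auto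
      have "S x (w x) = 0"
        using x w_le[OF x01(1)] by (simp add: S_def g_def)
      then have "R x (w x) + 2 * B * h x * h' x = - (2 * f x \<beta>)"
        using f_eq[OF x01(1)] by (simp add: R_def algebra_simps)
      moreover have "0 < f x \<beta>" using f_pos x01(2) x by blast
      ultimately have "R x (w x) + 2 * B * h x * h' x < 0" by simp
      from has_real_derivative_neg_dec_right[OF g[OF x01(1)] this]
      obtain d where d: "0 < d"
        "\<And>k. 0 < k \<Longrightarrow> x + k \<in> {0..1} \<Longrightarrow> k < d \<Longrightarrow> g (x + k) < g x"
        by blast
      define k where "k = min (d / 2) (1 - x)"
      have "0 < k" "x + k \<in> {u..1}" "k < d"
        using d(1) x u by (auto simp: k_def min_def field_simps)
      then show ?thesis using d(2)[of k] u by (intro bexI[of _ "x + k"]) auto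
    qed
    obtain x where x: "x \<in> {u..1}" "\<And>y. y \<in> {u..1} \<Longrightarrow> g x \<le> g y"
      using continuous_attains_inf[of "{u..1}" g] continuous_on_subset[OF g_cont, of "{u..1}"] u
      by auto
    \<comment> \<open>If the minimum is attained at \<open>1\<close>, where \<open>g\<close> vanishes, then it is also attained at \<open>u\<close>.\<close>
    have "g 1 = 0" by (simp add: g_def w_1 h_1)
    then have "x = 1 \<Longrightarrow> g u = 0"
      using x(2)[of u] u \<open>\<not> 0 < g u\<close> by auto
    moreover have "g x \<le> 0" using x(2)[of u] u \<open>\<not> 0 < g u\<close> by auto
    ultimately show False
      using not_min[of u] not_min[of x] x \<open>g 1 = 0\<close> u by (cases "x = 1") force+
  qed
  show ?thesis
  proof (rule that[of w])
    fix u :: real assume u: "0 < u" "u < 1"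
    show "0 < w u + B * (h u)\<^sup>2" using g_pos[OF u] by (simp add: g_def)
    show "w u \<le> 0" using w_le u by simp
    then have "S u (w u) = sqrt (w u + B * (h u)\<^sup>2)"
      using g_pos[OF u] by (simp add: S_def g_def)
    then show "(w has_real_derivative 2 * (c * sqrt (w u + B * (h u)\<^sup>2) - A * h u)) (at u)"
      using w[of u] u by (simp add: R_def at_within_Icc_at)
  qed
qed

lemma monotone_front_exists:
  assumes c: "A \<le> c * sqrt B"
  shows "\<exists>U. monotone_front f \<beta> c U"
proof -
  obtain w where w: "\<And>u. 0 < u \<Longrightarrow> u < 1 \<Longrightarrow>
      (w has_real_derivative 2 * (c * sqrt (w u + B * (h u)\<^sup>2) - A * h u)) (at u)"
    and w_le: "\<And>u. 0 < u \<Longrightarrow> u < 1 \<Longrightarrow> w u \<le> 0"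
    and w_pos: "\<And>u. 0 < u \<Longrightarrow> u < 1 \<Longrightarrow> 0 < w u + B * (h u)\<^sup>2"
    using trajectory_exists[OF c] by blast
  define p where "p u = sqrt (w u + B * (h u)\<^sup>2)" for u
  have p_pos: "0 < p u" if "0 < u" "u < 1" for u
    using w_pos[OF that] by (simp add: p_def)
  have p_der: "(p has_real_derivative (c * p u - f u \<beta>) / p u) (at u)" if u: "0 < u" "u < 1" for u
  proof -
    have "(w has_real_derivative 2 * (c * p u - A * h u)) (at u)"
      "(h has_real_derivative h' u) (at u)"
      using w[of u] h_deriv[of u] u by (simp_all add: at_within_Icc_at p_def)
    then have "((\<lambda>u. w u + B * (h u)\<^sup>2) has_real_derivative
        2 * (c * p u - A * h u) + 2 * B * h u * h' u) (at u)"
      by (auto intro!: derivative_eq_intros)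
    moreover have "2 * (c * p u - A * h u) + 2 * B * h u * h' u = 2 * (c * p u - f u \<beta>)"
      using f_eq[of u] u by (simp add: algebra_simps)
    ultimately have "((\<lambda>u. w u + B * (h u)\<^sup>2) has_real_derivative 2 * (c * p u - f u \<beta>)) (at u)"
      by (simp only:)
    from DERIV_chain2[OF DERIV_real_sqrt[OF w_pos[OF u]] this]
    have "(p has_real_derivative inverse (p u) / 2 * (2 * (c * p u - f u \<beta>))) (at u)"
      unfolding p_def .
    moreover have "inverse (p u) / 2 * (2 * (c * p u - f u \<beta>)) = (c * p u - f u \<beta>) / p u"
      using p_pos[OF u] by (simp add: field_simps)
    ultimately show ?thesis by (simp only:)
  qed
  have p_le: "p u \<le> sqrt B * h u" if u: "0 < u" "u < 1" for u
  proof -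
    have "p u \<le> sqrt (B * (h u)\<^sup>2)"
      unfolding p_def using w_le[OF u] by (intro real_sqrt_le_mono) simp
    then show ?thesis using h_nonneg[of u] u by (simp add: real_sqrt_mult)
  qed
  obtain K0 where K0: "0 < K0" "\<And>u. u \<in> {0..1} \<Longrightarrow> \<bar>h u\<bar> \<le> K0 * \<bar>u - 0\<bar>"
    by (rule linear_bound_at_zero[OF compact_Icc h_cont h_deriv h_0]) auto
  obtain K1 where K1: "0 < K1" "\<And>u. u \<in> {0..1} \<Longrightarrow> \<bar>h u\<bar> \<le> K1 * \<bar>u - 1\<bar>"
    by (rule linear_bound_at_zero[OF compact_Icc h_cont h_deriv h_1]) auto
  define K where "K = sqrt B * max K0 K1"
  have K_pos: "0 < K" using B_pos K0(1) by (simp add: K_def less_max_iff_disj)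
  have p_le_K: "p u \<le> K * d" if u: "0 < u" "u < 1" and d: "h u \<le> K' * d" "0 \<le> d" "K' \<le> max K0 K1"
    for u d K'
  proof -
    have "h u \<le> max K0 K1 * d"
      using d mult_right_mono[OF d(3,2)] by linarith
    then have "sqrt B * h u \<le> sqrt B * (max K0 K1 * d)"
      using B_pos by (intro mult_left_mono) auto
    then show ?thesis using p_le[OF u] by (simp add: K_def mult.assoc)
  qed
  have p_cont: "continuous_on {0<..<1} p"
    by (intro continuous_at_imp_continuous_on ballI DERIV_isCont[OF p_der]) auto
  have p_le_0: "p u \<le> K * u" if "0 < u" "u < 1" for u
    using K0(2)[of u] that by (intro p_le_K[where K' = K0]) auto
  have p_le_1: "p u \<le> K * (1 - u)" if "0 < u" "u < 1" for u
    using K1(2)[of u] that by (intro p_le_K[where K' = K1]) auto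
  obtain U where U: "\<And>z. 0 < U z" "\<And>z. U z < 1"
    "\<And>z. (U has_real_derivative - p (U z)) (at z)"
    "antimono U" "(U \<longlongrightarrow> 1) at_bot" "(U \<longlongrightarrow> 0) at_top"
    by (rule decreasing_profile_exists[of p K]) (assumption | rule p_cont p_pos K_pos p_le_0 p_le_1 that)+
  have "((\<lambda>z. - p (U z)) has_real_derivative c * p (U z) - f (U z) \<beta>) (at z)" for z
    using DERIV_minus[OF DERIV_chain2[OF p_der[OF U(1,2)] U(3)], of z] p_pos[OF U(1,2), of z]
    by simp
  then have "\<exists>U' U''. \<forall>z. (U has_real_derivative U' z) (at z) \<and>
      (U' has_real_derivative U'' z) (at z) \<and> U'' z + c * U' z + f (U z) \<beta> = 0"
    using U(3) by (intro exI[of _ "\<lambda>z. - p (U z)"] exI[of _ "\<lambda>z. c * p (U z) - f (U z) \<beta>"]) auto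
  then show ?thesis
    using U(4-6) unfolding monotone_front_def by blast
qed

section \<open>No fronts below the speed \<open>A / sqrt B\<close>\<close>

lemma h_comp_deriv:
  assumes "(U has_real_derivative d) (at z)" "range U \<subseteq> {0..1}"
  shows "((\<lambda>z. h (U z)) has_real_derivative h' (U z) * d) (at z)"
proof -
  have "(h has_real_derivative h' (U z)) (at (U z) within range U)"
    using assms by (intro DERIV_subset[OF h_deriv]) (auto simp: image_subset_iff)
  from DERIV_image_chain[OF this assms(1)] show ?thesis by (simp add: o_def)
qed

text \<open>
  Two incompatible bounds on the decay rate \<open>r = - U' / U\<close> of a front with \<open>c sqrt B < A\<close>. On
  the one hand \<open>r \<le> c\<close>: otherwise \<open>- U' - c U\<close>, which is nondecreasing as \<open>f \<ge> 0\<close>, would be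
  positive somewhere and drive \<open>U\<close> below \<open>0\<close>. On the other hand \<open>r \<ge> sqrt B h(U) / U\<close>, which
  tends to \<open>sqrt B\<close>, and from there on \<open>r\<close> increases at a rate bounded below.
\<close>

lemma monotone_front_speed_ge:
  assumes front: "monotone_front f \<beta> c U" and c: "0 \<le> c" and AB: "A < 2 * B"
  shows "A \<le> c * sqrt B"
proof (rule ccontr)
  assume "\<not> A \<le> c * sqrt B"
  then have slow: "c * sqrt B < A" by simp
  from front obtain U' U'' where anti: "antimono U"
    and U: "\<And>z. (U has_real_derivative U' z) (at z)"
    and U': "\<And>z. (U' has_real_derivative U'' z) (at z)"
    and eq: "\<And>z. U'' z + c * U' z + f (U z) \<beta> = 0"
    and lim_bot: "(U \<longlongrightarrow> 1) at_bot" and lim_top: "(U \<longlongrightarrow> 0) at_top"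
    unfolding monotone_front_def by metis
  have ode: "U'' z = - c * U' z - f (U z) \<beta>" for z
    using eq[of z] by simp
  have U_le: "U z \<le> 1" for z
    by (rule tendsto_lowerbound[OF lim_bot])
      (use anti in \<open>auto simp: antimono_def intro: eventually_mono[OF eventually_le_at_bot[of z]]\<close>)
  have U_ge: "0 \<le> U z" for z
    by (rule tendsto_upperbound[OF lim_top])
      (use anti in \<open>auto simp: antimono_def intro: eventually_mono[OF eventually_ge_at_top[of z]]\<close>)
  have U_mem: "U z \<in> {0..1}" for z using U_le U_ge by simp
  have U'_le: "U' z \<le> 0" for z
  proof -
    have "0 \<le> - U' z"
    proof (rule mono_on_imp_deriv_nonneg)
      show "mono_on UNIV (\<lambda>z. - U z)"
        using anti by (auto simp: mono_on_def antimono_def)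
      show "((\<lambda>z. - U z) has_real_derivative - U' z) (at z)"
        by (intro DERIV_minus U)
    qed auto
    then show ?thesis by simp
  qed

  \<comment> \<open>\<open>W\<close> is \<open>w\<close> along the front. Wherever it is negative it is nondecreasing in \<open>z\<close>, so one
    negative value would keep it away from \<open>0\<close> as \<open>z\<close> tends to \<open>- \<infinity>\<close>; but \<open>W \<ge> - B (h U)\<^sup>2\<close>,
    which tends to \<open>0\<close> there.\<close>
  define W where "W z = (U' z)\<^sup>2 - B * (h (U z))\<^sup>2" for z
  define W' where "W' z = - (2 * U' z * (c * U' z + A * h (U z)))" for z
  have W: "(W has_real_derivative W' z) (at z)" for z
  proof -
    have "((\<lambda>z. h (U z)) has_real_derivative h' (U z) * U' z) (at z)"
      using U_mem by (intro h_comp_deriv U) auto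
    with U'[of z] have "(W has_real_derivative
        2 * U' z * U'' z - B * (2 * h (U z) * (h' (U z) * U' z))) (at z)"
      unfolding W_def by (auto intro!: derivative_eq_intros)
    moreover have "2 * U' z * U'' z - B * (2 * h (U z) * (h' (U z) * U' z)) = W' z"
      unfolding W'_def ode f_eq[OF U_mem] by (simp add: algebra_simps)
    ultimately show ?thesis by simp
  qed
  have W_nonneg: "0 \<le> W z" for z
  proof (rule ccontr)
    assume neg: "\<not> 0 \<le> W z"
    have W_le: "W x \<le> W z" if x: "x \<le> z" for x
    proof -
      have "- W (- (- z)) \<le> - W (- (- x))"
      proof (rule le_of_deriv_nonneg_while_pos[where \<phi> = "\<lambda>t. - W (- t)" and \<phi>' = "\<lambda>t. W' (- t)"])
        show "((\<lambda>t. - W (- t)) has_real_derivative W' (- t)) (at t within {- z..- x})" for t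
        proof -
          have "((\<lambda>t. W (- t)) has_real_derivative W' (- t) * - 1) (at t within {- z..- x})"
            by (rule DERIV_chain2[OF W]) (auto intro!: derivative_eq_intros)
          from DERIV_minus[OF this] show ?thesis by simp
        qed
        show "0 \<le> W' (- t)" if "0 < - W (- t)" for t
        proof -
          have "(U' (- t))\<^sup>2 \<le> (sqrt B * h (U (- t)))\<^sup>2"
            using that B_pos by (simp add: W_def power_mult_distrib)
          then have "- U' (- t) \<le> sqrt B * h (U (- t))"
            using U'_le[of "- t"] B_pos h_nonneg[OF U_mem[of "- t"]]
            by (intro power2_le_imp_le[of "- U' (- t)"]) auto
          then have "c * - U' (- t) \<le> c * (sqrt B * h (U (- t)))"
            using c by (rule mult_left_mono)
          also have "\<dots> \<le> A * h (U (- t))"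
            using mult_right_mono[OF less_imp_le[OF slow] h_nonneg[OF U_mem[of "- t"]]]
            by (simp add: mult.assoc)
          finally have "0 \<le> c * U' (- t) + A * h (U (- t))" by simp
          then show ?thesis
            using U'_le[of "- t"] by (simp add: W'_def mult_nonpos_nonneg)
        qed
      qed (use x neg in auto)
      then show ?thesis by simp
    qed
    have "((\<lambda>x. - (B * (h (U x))\<^sup>2)) \<longlongrightarrow> - (B * (h 1)\<^sup>2)) at_bot"
    proof (intro tendsto_intros)
      show "((\<lambda>x. h (U x)) \<longlongrightarrow> h 1) at_bot"
        using U_mem by (intro continuous_on_tendsto_compose[OF h_cont lim_bot]) auto
    qed
    then have "((\<lambda>x. - (B * (h (U x))\<^sup>2)) \<longlongrightarrow> 0) at_bot"
      by (simp add: h_1)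
    moreover have "\<forall>\<^sub>F x in at_bot. - (B * (h (U x))\<^sup>2) \<le> W z"
      using eventually_le_at_bot[of z]
    proof eventually_elim
      case (elim x)
      then show ?case using W_le[of x] by (simp add: W_def) (smt (verit) zero_le_power2)
    qed
    ultimately have "0 \<le> W z"
      by (rule tendsto_upperbound) simp
    with neg show False by simp
  qed
  have steep: "sqrt B * h (U z) \<le> - U' z" for z
  proof (rule power2_le_imp_le)
    show "(sqrt B * h (U z))\<^sup>2 \<le> (- U' z)\<^sup>2"
      using W_nonneg[of z] B_pos by (simp add: W_def power_mult_distrib)
  qed (use U'_le in simp)

  have U'_ge: "- U' z \<le> c * U z" for z
  proof (rule ccontr)
    assume "\<not> - U' z \<le> c * U z"
    define d where "d = - U' z - c * U z"
    have d: "0 < d" using \<open>\<not> - U' z \<le> c * U z\<close> by (simp add: d_def)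
    have drop: "d \<le> - U' x" if x: "z \<le> x" for x
    proof -
      have "- U' z - c * U z \<le> - U' x - c * U x"
      proof (rule DERIV_nonneg_imp_nondecreasing[where f = "\<lambda>y. - U' y - c * U y", OF x])
        fix y
        have "((\<lambda>y. - U' y - c * U y) has_real_derivative - U'' y - c * U' y) (at y)"
          by (intro DERIV_diff DERIV_minus DERIV_cmult U U')
        then have "((\<lambda>y. - U' y - c * U y) has_real_derivative f (U y) \<beta>) (at y)"
          by (simp add: ode)
        then show "\<exists>D. ((\<lambda>y. - U' y - c * U y) has_real_derivative D) (at y) \<and> 0 \<le> D"
          using f_nonneg[OF U_mem] by blast
      qed
      moreover have "0 \<le> c * U x" using c U_ge by simp
      ultimately show ?thesis by (simp add: d_def)
    qed
    have "- U z - d * z \<le> - U (z + 2 / d) - d * (z + 2 / d)"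
    proof (rule DERIV_nonneg_imp_nondecreasing[where f = "\<lambda>y. - U y - d * y"])
      show "z \<le> z + 2 / d" using d by simp
      fix y assume y: "z \<le> y"
      have "((\<lambda>y. - U y - d * y) has_real_derivative - U' y - d * 1) (at y)"
        by (intro DERIV_diff DERIV_minus DERIV_cmult U DERIV_ident)
      then show "\<exists>D. ((\<lambda>y. - U y - d * y) has_real_derivative D) (at y) \<and> 0 \<le> D"
        using drop[OF y] by (intro exI[of _ "- U' y - d * 1"]) auto
    qed
    then have "U (z + 2 / d) \<le> U z - 2" using d by (simp add: algebra_simps)
    then show False using U_ge[of "z + 2 / d"] U_le[of z] by simp
  qed
  \<comment> \<open>Since \<open>U' \<ge> - c U\<close>, a front that vanishes at \<open>z\<close> vanishes at all \<open>x \<le> z\<close>.\<close>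
  have U_pos: "0 < U z" for z
  proof (rule ccontr)
    assume "\<not> 0 < U z"
    then have Uz: "U z = 0" using U_ge[of z] by simp
    have "U x = 0" if x: "x \<le> z" for x
    proof -
      have "U x * exp (c * x) \<le> U z * exp (c * z)"
      proof (rule DERIV_nonneg_imp_nondecreasing[where f = "\<lambda>x. U x * exp (c * x)", OF x])
        fix y
        have "((\<lambda>x. U x * exp (c * x)) has_real_derivative (U' y + c * U y) * exp (c * y)) (at y)"
          using U[of y] by (auto intro!: derivative_eq_intros simp: algebra_simps)
        moreover have "0 \<le> (U' y + c * U y) * exp (c * y)"
          using U'_ge[of y] by simp
        ultimately show "\<exists>D. ((\<lambda>x. U x * exp (c * x)) has_real_derivative D) (at y) \<and> 0 \<le> D"
          by blast
      qed
      then show ?thesis using Uz U_ge[of x] by (simp add: mult_le_0_iff)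
    qed
    then have "\<forall>\<^sub>F x in at_bot. U x = 0"
      by (rule eventually_mono[OF eventually_le_at_bot])
    then have "(U \<longlongrightarrow> 0) at_bot"
      by (rule tendsto_eventually)
    then show False
      using tendsto_unique[OF _ lim_bot] by fastforce
  qed

  have U_right: "filterlim U (at_right 0) at_top"
    using lim_top U_pos by (simp add: filterlim_at less_imp_neq[symmetric])
  have h_lim: "((\<lambda>z. h (U z) / U z) \<longlongrightarrow> 1) at_top"
    by (rule filterlim_compose[OF h_quotient_tendsto U_right])
  have f_lim: "((\<lambda>z. f (U z) \<beta> / U z) \<longlongrightarrow> A - B) at_top"
    by (rule filterlim_compose[OF f_quotient_tendsto U_right])
  define r where "r z = - U' z / U z" for z
  define m where "m z = sqrt B * (h (U z) / U z)" for z
  have r_der: "(r has_real_derivative (r z)\<^sup>2 - c * r z + f (U z) \<beta> / U z) (at z)" for z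
  proof -
    have "(r has_real_derivative (- U'' z * U z - - U' z * U' z) / (U z * U z)) (at z)"
      unfolding r_def using U_pos[of z] by (intro DERIV_divide DERIV_minus U U') simp
    moreover have "(- U'' z * U z - - U' z * U' z) / (U z * U z) =
        (r z)\<^sup>2 - c * r z + f (U z) \<beta> / U z"
      unfolding r_def ode using U_pos[of z] by (simp add: field_simps power2_eq_square)
    ultimately show ?thesis by simp
  qed
  have r_le: "r z \<le> c" for z
    using U'_ge[of z] U_pos[of z] unfolding r_def by (subst pos_divide_le_eq)
  have m_le: "m z \<le> r z" for z
    using divide_right_mono[OF steep[of z] U_ge[of z]] by (simp add: m_def r_def)
  have m_lim: "(m \<longlongrightarrow> sqrt B) at_top"
    unfolding m_def using tendsto_mult[OF tendsto_const h_lim, of "sqrt B"] by simp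
  \<comment> \<open>\<open>\<eta>\<close> is half the limit of the quadratic at \<open>m\<close>; beyond \<open>c / 2\<close> the quadratic increases, so
    its value at \<open>r \<ge> m\<close> is at least as large.\<close>
  define \<eta> where "\<eta> = (A - c * sqrt B) / 2"
  have \<eta>: "0 < \<eta>" using slow by (simp add: \<eta>_def)
  have "((\<lambda>z. (m z)\<^sup>2 - c * m z + f (U z) \<beta> / U z) \<longlongrightarrow> (sqrt B)\<^sup>2 - c * sqrt B + (A - B)) at_top"
    by (intro tendsto_intros m_lim f_lim)
  then have "\<forall>\<^sub>F z in at_top. \<eta> < (m z)\<^sup>2 - c * m z + f (U z) \<beta> / U z"
    using B_pos \<eta> by (intro order_tendstoD) (auto simp: \<eta>_def)
  moreover have "\<forall>\<^sub>F z in at_top. c / 2 < m z"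
  proof (rule order_tendstoD(1)[OF m_lim])
    have "2 * sqrt B * sqrt B = 2 * B" using B_pos by simp
    then have "c * sqrt B < 2 * sqrt B * sqrt B" using slow AB by linarith
    then have "c < 2 * sqrt B"
      by (rule mult_right_less_imp_less) (use B_pos in simp)
    then show "c / 2 < sqrt B" by simp
  qed
  ultimately have "\<forall>\<^sub>F z in at_top. \<eta> \<le> (r z)\<^sup>2 - c * r z + f (U z) \<beta> / U z"
  proof eventually_elim
    case (elim z)
    have "0 \<le> (r z - m z) * (r z + m z - c)"
      using elim m_le[of z] by (intro mult_nonneg_nonneg) auto
    then show ?case using elim by (simp add: algebra_simps power2_eq_square)
  qed
  then obtain Z where Z: "\<And>z. Z \<le> z \<Longrightarrow> \<eta> \<le> (r z)\<^sup>2 - c * r z + f (U z) \<beta> / U z"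
    unfolding eventually_at_top_linorder by blast
  define T where "T = (c + 1) / \<eta>"
  have "r Z - \<eta> * Z \<le> r (Z + T) - \<eta> * (Z + T)"
  proof (rule DERIV_nonneg_imp_nondecreasing[where f = "\<lambda>y. r y - \<eta> * y"])
    show "Z \<le> Z + T" using c \<eta> by (simp add: T_def)
    fix y assume y: "Z \<le> y"
    have "((\<lambda>y. r y - \<eta> * y) has_real_derivative
        ((r y)\<^sup>2 - c * r y + f (U y) \<beta> / U y) - \<eta> * 1) (at y)"
      by (intro DERIV_diff DERIV_cmult DERIV_ident r_der)
    then show "\<exists>D. ((\<lambda>y. r y - \<eta> * y) has_real_derivative D) (at y) \<and> 0 \<le> D"
      using Z[OF y] by (intro exI conjI) auto
  qed
  moreover have "\<eta> * T = c + 1" using \<eta> by (simp add: T_def)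
  ultimately have "r Z + (c + 1) \<le> r (Z + T)"
    by (simp add: algebra_simps)
  moreover have "0 \<le> r Z"
    using U'_le[of Z] U_ge[of Z] by (simp add: r_def divide_nonpos_nonneg)
  ultimately show False
    using r_le[of "Z + T"] by simp
qed

end

section \<open>The minimal speed\<close>

lemma solvable_monostableI:
  assumes "monostable f \<beta>" "solvable_type f h h' A B"
  shows "solvable_monostable f \<beta> h h' (A \<beta>) (B \<beta>)"
proof
  show "\<exists>D. ((\<lambda>u. f u \<beta>) has_real_derivative D) (at 0 within {0..1})"
    using assms(1) by (auto simp: monostable_def)
qed (use assms in \<open>auto simp: monostable_def solvable_type_def\<close>)

theorem lemma3:
  fixes f :: "real \<Rightarrow> real \<Rightarrow> real" and h h' A B :: "real \<Rightarrow> real"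
  assumes "\<And>\<beta>. monostable f \<beta>"
    and "solvable_type f h h' A B"
  shows "\<forall>\<beta>. A \<beta> < 2 * B \<beta> \<longrightarrow> c_min f \<beta> = c_nl A B \<beta>"
proof (intro allI impI)
  fix \<beta> assume AB: "A \<beta> < 2 * B \<beta>"
  interpret solvable_monostable f \<beta> h h' "A \<beta>" "B \<beta>"
    using assms by (intro solvable_monostableI)
  have speed: "c_nl A B \<beta> \<le> c \<longleftrightarrow> A \<beta> \<le> c * sqrt (B \<beta>)" for c
    using B_pos by (simp add: c_nl_def pos_divide_le_eq)
  show "c_min f \<beta> = c_nl A B \<beta>"
    unfolding c_min_def
  proof (rule Least_equality)
    show "0 \<le> c_nl A B \<beta> \<and> (\<forall>c'\<ge>c_nl A B \<beta>. \<exists>U. monotone_front f \<beta> c' U)"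
      using A_pos B_pos monotone_front_exists speed by (auto simp: c_nl_def)
    show "c_nl A B \<beta> \<le> c" if "0 \<le> c \<and> (\<forall>c'\<ge>c. \<exists>U. monotone_front f \<beta> c' U)" for c
      using that monotone_front_speed_ge[OF _ _ AB] speed by blast
  qed
qed

end
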